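(* The monoids $\mathsf{tlep}\mathcal{RM}^{\mathsf{fin}}_2$, $\mathsf{tfl}\mathcal{RM}^{\mathsf{fin}}_2$, and $\mathsf{tlep}M_{2,1}$ $(=\mathsf{tfl}M_{2,1})$, as well as $\mathsf{plep}\mathcal{RM}^{\mathsf{fin}}_2$, $\mathsf{pfl}\mathcal{RM}^{\mathsf{fin}}_2$, and $\mathsf{plep}M_{2,1}$ $(=\mathsf{pfl}M_{2,1})$, are not finitely generated.
   Context: A prefix code over $\{0,1\}$ is a set of strings none of which is a proper prefix of another. A right ideal of $\{0,1\}^*$ is a set $R$ with $R=R\{0,1\}^*$; it equals $P\{0,1\}^*$ for a unique prefix code $P$. A right-ideal morphism is a partial function $f:\{0,1\}^*\to\{0,1\}^*$ whose domain is a right ideal and such that $f(xu)=f(x)u$ for all $x\in\mathrm{Dom}(f)$, $u\in\{0,1\}^*$. $\mathrm{domC}(f)$ is the prefix code of $\mathrm{Dom}(f)$. $\mathcal{RM}^{\mathsf{fin}}_2$ is the monoid under composition of all right-ideal morphisms of $\{0,1\}^*$ with finite domain code. A right-ideal morphism $f$ is total if $\mathrm{domC}(f)$ is a maximal prefix code. $f$ is plep (partial length-equality preserving) if for all $x_1,x_2\in\mathrm{Dom}(f)$: $|x_1|=|x_2|$ implies $|f(x_1)|=|f(x_2)|$. $f$ is tlep if it is plep and total; $f$ is pfl if it is plep and $\mathrm{domC}(f)\subseteq\{0,1\}^m$ for some $m\ge0$; $f$ is tfl if it is tlep and $\mathrm{domC}(f)=\{0,1\}^m$ for some $m\ge0$.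 The submonoids of $\mathcal{RM}^{\mathsf{fin}}_2$ consisting of the plep, tlep, pfl, tfl elements are denoted $\mathsf{plep}\mathcal{RM}^{\mathsf{fin}}_2$, $\mathsf{tlep}\mathcal{RM}^{\mathsf{fin}}_2$, $\mathsf{pfl}\mathcal{RM}^{\mathsf{fin}}_2$, $\mathsf{tfl}\mathcal{RM}^{\mathsf{fin}}_2$. For $f,g\in\mathcal{RM}^{\mathsf{fin}}_2$, $f\equiv_{\rm fin}g$ iff the symmetric difference of $\mathrm{Dom}(f)$ and $\mathrm{Dom}(g)$ is finite and $f,g$ agree on $\mathrm{Dom}(f)\cap\mathrm{Dom}(g)$; this is a congruence. $\mathsf{tlep}M_{2,1}=\mathsf{tlep}\mathcal{RM}^{\mathsf{fin}}_2/\!\equiv_{\rm fin}$, $\mathsf{tfl}M_{2,1}=\mathsf{tfl}\mathcal{RM}^{\mathsf{fin}}_2/\!\equiv_{\rm fin}$, and similarly for plep and pfl; $\mathsf{tlep}M_{2,1}$ and $\mathsf{tfl}M_{2,1}$ are identified (they are isomorphic), as are $\mathsf{plep}M_{2,1}$ and $\mathsf{pfl}M_{2,1}$. *)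

theory Defs
  imports "HOL-Algebra.Group" "HOL-Library.Sublist"
begin

section \<open>Right ideals and prefix codes of \<open>{0,1}\<^sup>*\<close>\<close>

text \<open>Strings over \<open>{0,1}\<close> are lists of booleans.\<close>

type_synonym str = "bool list"

definition prefix_code :: "str set \<Rightarrow> bool" where
  "prefix_code P \<longleftrightarrow> (\<forall>x\<in>P. \<forall>y\<in>P. \<not> strict_prefix x y)"

definition maximal_prefix_code :: "str set \<Rightarrow> bool" where
  "maximal_prefix_code P \<longleftrightarrow> prefix_code P \<and> (\<forall>Q. prefix_code Q \<and> P \<subseteq> Q \<longrightarrow> Q = P)"

text \<open>\<open>ideal_of P\<close> is the set \<open>P{0,1}\<^sup>*\<close>.\<close>

definition ideal_of :: "str set \<Rightarrow> str set" where
  "ideal_of P = {x @ u | x u. x \<in> P}"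

definition right_ideal :: "str set \<Rightarrow> bool" where
  "right_ideal R \<longleftrightarrow> R = ideal_of R"

definition strings_of_length :: "nat \<Rightarrow> str set" where
  "strings_of_length m = {x. length x = m}"


section \<open>Right-ideal morphisms\<close>

definition ri_morphism :: "(str \<rightharpoonup> str) \<Rightarrow> bool" where
  "ri_morphism f \<longleftrightarrow> right_ideal (dom f) \<and> (\<forall>x\<in>dom f. \<forall>u. f (x @ u) = Some (the (f x) @ u))"

text \<open>Meaningful whenever \<^term>\<open>dom f\<close> is a right ideal; see \<open>ex1_prefix_code\<close> below.\<close>

definition domC :: "(str \<rightharpoonup> str) \<Rightarrow> str set" where
  "domC f = (THE P. prefix_code P \<and> ideal_of P = dom f)"

definition RM_fin :: "(str \<rightharpoonup> str) set" where
  "RM_fin = {f. ri_morphism f \<and> finite (domC f)}"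

definition total_rim :: "(str \<rightharpoonup> str) \<Rightarrow> bool" where
  "total_rim f \<longleftrightarrow> maximal_prefix_code (domC f)"

definition plep :: "(str \<rightharpoonup> str) \<Rightarrow> bool" where
  "plep f \<longleftrightarrow> (\<forall>x\<^sub>1\<in>dom f. \<forall>x\<^sub>2\<in>dom f.
     length x\<^sub>1 = length x\<^sub>2 \<longrightarrow> length (the (f x\<^sub>1)) = length (the (f x\<^sub>2)))"

definition tlep :: "(str \<rightharpoonup> str) \<Rightarrow> bool" where
  "tlep f \<longleftrightarrow> plep f \<and> total_rim f"

definition pfl :: "(str \<rightharpoonup> str) \<Rightarrow> bool" where
  "pfl f \<longleftrightarrow> plep f \<and> (\<exists>m. domC f \<subseteq> strings_of_length m)"

definition tfl :: "(str \<rightharpoonup> str) \<Rightarrow> bool" where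
  "tfl f \<longleftrightarrow> tlep f \<and> (\<exists>m. domC f = strings_of_length m)"


section \<open>The monoids\<close>

text \<open>\<open>RM_monoid P\<close> consists of the \<open>f \<in> RM_fin\<close> with property \<open>P\<close>, under composition
  of partial functions; the identity function is \<^term>\<open>Some\<close>.\<close>

definition RM_monoid :: "((str \<rightharpoonup> str) \<Rightarrow> bool) \<Rightarrow> (str \<rightharpoonup> str) monoid" where
  "RM_monoid P = \<lparr>carrier = {f \<in> RM_fin. P f}, mult = (\<circ>\<^sub>m), one = Some\<rparr>"

definition RM2fin :: "(str \<rightharpoonup> str) monoid" where
  "RM2fin = RM_monoid (\<lambda>_. True)"

definition plepRM :: "(str \<rightharpoonup> str) monoid" where "plepRM = RM_monoid plep"
definition tlepRM :: "(str \<rightharpoonup> str) monoid" where "tlepRM = RM_monoid tlep"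
definition pflRM :: "(str \<rightharpoonup> str) monoid" where "pflRM = RM_monoid pfl"
definition tflRM :: "(str \<rightharpoonup> str) monoid" where "tflRM = RM_monoid tfl"

definition fin_equiv :: "(str \<rightharpoonup> str) \<Rightarrow> (str \<rightharpoonup> str) \<Rightarrow> bool" where
  "fin_equiv f g \<longleftrightarrow> finite ((dom f - dom g) \<union> (dom g - dom f)) \<and>
     (\<forall>x \<in> dom f \<inter> dom g. f x = g x)"

text \<open>Quotient of a monoid by a congruence \<open>r\<close>. The product of two classes is the class of the
  product of any representatives; \<open>quotient_mult\<close> below confirms that the union
  taken here is such a class.\<close>

definition quotient_monoid :: "('a, 'b) monoid_scheme \<Rightarrow> ('a \<times> 'a) set \<Rightarrow> 'a set monoid" where
  "quotient_monoid M r =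
     \<lparr>carrier = carrier M // r,
      mult = (\<lambda>A B. \<Union>a\<in>A. \<Union>b\<in>B. r `` {a \<otimes>\<^bsub>M\<^esub> b}),
      one = r `` {\<one>\<^bsub>M\<^esub>}\<rparr>"

definition mod_fin_equiv :: "(str \<rightharpoonup> str) monoid \<Rightarrow> (str \<rightharpoonup> str) set monoid" where
  "mod_fin_equiv M =
     quotient_monoid M {(f, g). f \<in> carrier M \<and> g \<in> carrier M \<and> fin_equiv f g}"

definition plepM :: "(str \<rightharpoonup> str) set monoid" where "plepM = mod_fin_equiv plepRM"
definition tlepM :: "(str \<rightharpoonup> str) set monoid" where "tlepM = mod_fin_equiv tlepRM"
definition pflM :: "(str \<rightharpoonup> str) set monoid" where "pflM = mod_fin_equiv pflRM"
definition tflM :: "(str \<rightharpoonup> str) set monoid" where "tflM = mod_fin_equiv tflRM"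


section \<open>Finite generation\<close>

inductive_set generated_submonoid :: "('a, 'b) monoid_scheme \<Rightarrow> 'a set \<Rightarrow> 'a set"
  for M (structure) and S where
  one: "\<one> \<in> generated_submonoid M S"
| incl: "s \<in> S \<Longrightarrow> s \<in> generated_submonoid M S"
| mult: "x \<in> generated_submonoid M S \<Longrightarrow> y \<in> generated_submonoid M S
    \<Longrightarrow> x \<otimes> y \<in> generated_submonoid M S"

definition finitely_generated_monoid :: "('a, 'b) monoid_scheme \<Rightarrow> bool" where
  "finitely_generated_monoid M \<longleftrightarrow>
     (\<exists>S. finite S \<and> S \<subseteq> carrier M \<and> generated_submonoid M S = carrier M)"


section \<open>The definitions are meaningful\<close>

lemma ideal_of_iff: "x \<in> ideal_of P \<longleftrightarrow> (\<exists>p\<in>P. prefix p x)"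
  by (auto simp: ideal_of_def prefix_def)

lemma right_ideal_iff: "right_ideal R \<longleftrightarrow> (\<forall>x\<in>R. \<forall>u. x @ u \<in> R)"
proof
  assume "right_ideal R"
  then show "\<forall>x\<in>R. \<forall>u. x @ u \<in> R" unfolding right_ideal_def ideal_of_def by blast
next
  assume *: "\<forall>x\<in>R. \<forall>u. x @ u \<in> R"
  have "x \<in> ideal_of R" if "x \<in> R" for x
    unfolding ideal_of_def using that by (intro CollectI exI[of _ x] exI[of _ "[]"]) simp
  moreover have "ideal_of R \<subseteq> R" using * by (auto simp: ideal_of_def)
  ultimately show "right_ideal R" unfolding right_ideal_def by blast
qed

lemma right_ideal_prefix: "right_ideal R \<Longrightarrow> x \<in> R \<Longrightarrow> prefix x y \<Longrightarrow> y \<in> R"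
  by (auto simp: right_ideal_iff prefix_def)

definition minimal_words :: "str set \<Rightarrow> str set" where
  "minimal_words R = {x \<in> R. \<forall>y\<in>R. \<not> strict_prefix y x}"

lemma ex_minimal_prefix: "x \<in> R \<Longrightarrow> \<exists>p\<in>minimal_words R. prefix p x"
proof (induction "length x" arbitrary: x rule: less_induct)
  case less
  show ?case
  proof (cases "x \<in> minimal_words R")
    case False
    then obtain y where "y \<in> R" "strict_prefix y x"
      using less.prems by (auto simp: minimal_words_def)
    then show ?thesis
      using less.hyps[of y] by (meson prefix_length_less prefix_order.less_imp_le prefix_order.trans)
  qed auto
qed

lemma minimal_words_subset: "minimal_words R \<subseteq> R"
  by (auto simp: minimal_words_def)

lemma ideal_of_minimal_words: "right_ideal R \<Longrightarrow> ideal_of (minimal_words R) = R"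
  unfolding set_eq_iff ideal_of_iff
  using ex_minimal_prefix[of _ R] right_ideal_prefix[of R] minimal_words_subset[of R] by blast

lemma prefix_code_unique:
  assumes "prefix_code P" "ideal_of P = R"
  shows "P = minimal_words R"
proof
  show "P \<subseteq> minimal_words R"
    using assms unfolding minimal_words_def prefix_code_def
    by (auto simp: ideal_of_iff) (meson prefix_order.le_less_trans)
  show "minimal_words R \<subseteq> P"
  proof
    fix x assume x: "x \<in> minimal_words R"
    then obtain p where p: "p \<in> P" "prefix p x"
      using assms by (auto simp: minimal_words_def ideal_of_iff)
    then have "p \<in> R" using assms by (auto simp: ideal_of_iff)
    then show "x \<in> P" using x p by (auto simp: minimal_words_def prefix_order.less_le)
  qed
qed

lemma ex1_prefix_code:
  assumes "right_ideal R"
  shows "\<exists>!P. prefix_code P \<and> ideal_of P = R"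
proof
  show "prefix_code (minimal_words R) \<and> ideal_of (minimal_words R) = R"
    using ideal_of_minimal_words[OF assms] by (auto simp: prefix_code_def minimal_words_def)
qed (use prefix_code_unique in blast)

lemma domC_eq:
  assumes "ri_morphism f"
  shows "domC f = minimal_words (dom f)"
proof -
  have "\<exists>!P. prefix_code P \<and> ideal_of P = dom f"
    using assms by (intro ex1_prefix_code) (simp add: ri_morphism_def)
  from theI'[OF this] show ?thesis
    unfolding domC_def by (intro prefix_code_unique) simp_all
qed

lemma ri_morphism_append:
  "ri_morphism f \<Longrightarrow> f x = Some y \<Longrightarrow> f (x @ u) = Some (y @ u)"
  by (auto simp: ri_morphism_def dom_def)

lemma ri_morphismI:
  assumes "\<And>x y u. f x = Some y \<Longrightarrow> f (x @ u) = Some (y @ u)"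
  shows "ri_morphism f"
  unfolding ri_morphism_def right_ideal_iff by (auto dest: assms)

lemma ri_morphism_Some: "ri_morphism Some"
  by (rule ri_morphismI) auto

lemma ri_morphism_comp:
  "ri_morphism f \<Longrightarrow> ri_morphism g \<Longrightarrow> ri_morphism (f \<circ>\<^sub>m g)"
  by (rule ri_morphismI) (auto simp: map_comp_def ri_morphism_append split: option.splits)

lemma ri_morphism_dom_prefix:
  "ri_morphism f \<Longrightarrow> x \<in> dom f \<Longrightarrow> prefix x y \<Longrightarrow> y \<in> dom f"
  using right_ideal_prefix by (auto simp: ri_morphism_def)

lemma finite_bounded_strings: "finite {x :: str. length x \<le> n}"
  using finite_lists_length_le[of "UNIV :: bool set" n] by simp

lemma finite_domC_iff:
  assumes f: "ri_morphism f"
  shows "finite (domC f) \<longleftrightarrow> (\<exists>N. \<forall>x\<in>dom f. N \<le> length x \<longrightarrow> take N x \<in> dom f)"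
proof
  assume fin: "finite (domC f)"
  define N where "N = Max (insert 0 (length ` domC f))"
  have "take N x \<in> dom f" if x: "x \<in> dom f" "N \<le> length x" for x
  proof -
    obtain p where p: "p \<in> domC f" "prefix p x"
      using ex_minimal_prefix[OF x(1)] domC_eq[OF f] by auto
    then have "length p \<le> N" using fin by (auto simp: N_def)
    then have "prefix p (take N x)"
      using p(2) x(2) by (auto simp: prefix_def)
    moreover have "p \<in> dom f" using p(1) domC_eq[OF f] by (auto simp: minimal_words_def)
    ultimately show ?thesis using ri_morphism_dom_prefix[OF f] by blast
  qed
  then show "\<exists>N. \<forall>x\<in>dom f. N \<le> length x \<longrightarrow> take N x \<in> dom f" by blast
next
  assume "\<exists>N. \<forall>x\<in>dom f. N \<le> length x \<longrightarrow> take N x \<in> dom f"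
  then obtain N where N: "\<And>x. x \<in> dom f \<Longrightarrow> N \<le> length x \<Longrightarrow> take N x \<in> dom f" by blast
  have "length x \<le> N" if x: "x \<in> domC f" for x
  proof (rule ccontr)
    assume *: "\<not> length x \<le> N"
    have x': "x \<in> dom f" "\<forall>y\<in>dom f. \<not> strict_prefix y x"
      using x domC_eq[OF f] by (auto simp: minimal_words_def)
    have "strict_prefix (take N x) x"
      using * by (metis length_take min.cobounded2 strict_prefix_def take_is_prefix)
    then show False using N[of x] x' * by auto
  qed
  then have "domC f \<subseteq> {x. length x \<le> N}" by auto
  then show "finite (domC f)" by (rule finite_subset[OF _ finite_bounded_strings])
qed

lemma domC_fixed_length_iff:
  assumes f: "ri_morphism f"
  shows "domC f \<subseteq> strings_of_length m \<longleftrightarrow> (\<forall>x\<in>dom f. m \<le> length x \<and> take m x \<in> dom f)"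
proof
  assume sub: "domC f \<subseteq> strings_of_length m"
  show "\<forall>x\<in>dom f. m \<le> length x \<and> take m x \<in> dom f"
  proof
    fix x assume x: "x \<in> dom f"
    obtain p where p: "p \<in> domC f" "prefix p x"
      using ex_minimal_prefix[OF x(1)] domC_eq[OF f] by auto
    have "length p = m" using p sub by (auto simp: strings_of_length_def)
    moreover have "p \<in> dom f" using p(1) domC_eq[OF f] by (auto simp: minimal_words_def)
    ultimately show "m \<le> length x \<and> take m x \<in> dom f"
      using p(2) by (auto simp: prefix_def)
  qed
next
  assume *: "\<forall>x\<in>dom f. m \<le> length x \<and> take m x \<in> dom f"
  show "domC f \<subseteq> strings_of_length m"
  proof
    fix x assume "x \<in> domC f"
    then have x: "x \<in> dom f" "\<forall>y\<in>dom f. \<not> strict_prefix y x"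
      using domC_eq[OF f] by (auto simp: minimal_words_def)
    then have "take m x = x"
      using * by (metis strict_prefix_def take_is_prefix)
    moreover have "m \<le> length x" using * x(1) by blast
    ultimately show "x \<in> strings_of_length m"
      unfolding strings_of_length_def by (metis (mono_tags) length_take mem_Collect_eq min.absorb2)
  qed
qed

lemma total_rim_iff:
  assumes f: "ri_morphism f"
  shows "total_rim f \<longleftrightarrow> (\<forall>x. \<exists>u. x @ u \<in> dom f)"
proof
  have pc: "prefix_code (domC f)"
    by (auto simp: domC_eq[OF f] prefix_code_def minimal_words_def)
  have sub: "domC f \<subseteq> dom f" by (auto simp: domC_eq[OF f] minimal_words_def)
  {
    assume t: "total_rim f"
    show "\<forall>x. \<exists>u. x @ u \<in> dom f"
    proof (rule ccontr)
      assume "\<not> (\<forall>x. \<exists>u. x @ u \<in> dom f)"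
      then obtain x where x: "\<And>u. x @ u \<notin> dom f" by blast
      have no: "\<not> prefix x p \<and> \<not> prefix p x" if "p \<in> domC f" for p
      proof -
        have "p \<in> dom f" using that sub by blast
        then show ?thesis
          using x x[of "[]"] ri_morphism_dom_prefix[OF f, of p x] by (auto simp: prefix_def)
      qed
      have "prefix_code (insert x (domC f))"
        using pc no by (auto simp: prefix_code_def strict_prefix_def)
      then have "x \<in> domC f" using t by (auto simp: total_rim_def maximal_prefix_code_def)
      then show False using no by auto
    qed
  next
    assume d: "\<forall>x. \<exists>u. x @ u \<in> dom f"
    have "Q \<subseteq> domC f" if Q: "prefix_code Q" "domC f \<subseteq> Q" for Q
    proof
      fix x assume x: "x \<in> Q"
      obtain u where "x @ u \<in> dom f" using d by blast
      then obtain p where p: "p \<in> domC f" "prefix p (x @ u)"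
        using ex_minimal_prefix domC_eq[OF f] by metis
      then have "prefix p x \<or> prefix x p"
        using prefix_same_cases by (metis prefixI)
      then show "x \<in> domC f" using p(1) x Q by (auto simp: prefix_code_def strict_prefix_def)
    qed
    then show "total_rim f" using pc by (auto simp: total_rim_def maximal_prefix_code_def)
  }
qed

lemma tfl_iff:
  assumes f: "ri_morphism f"
  shows "tfl f \<longleftrightarrow> pfl f \<and> total_rim f"
proof -
  have "prefix_code (strings_of_length m)" for m
    by (auto simp: prefix_code_def strings_of_length_def dest: prefix_length_less)
  then have "domC f = strings_of_length m"
    if "total_rim f" "domC f \<subseteq> strings_of_length m" for m
    using that unfolding total_rim_def maximal_prefix_code_def by metis
  then show ?thesis unfolding tfl_def pfl_def tlep_def by blast
qed

lemma comp_dom_iff: "x \<in> dom (f \<circ>\<^sub>m g) \<longleftrightarrow> (\<exists>y. g x = Some y \<and> y \<in> dom f)"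
  by (auto simp: map_comp_def dom_def split: option.splits)

lemma RM_fin_comp:
  assumes "f \<in> RM_fin" "g \<in> RM_fin"
  shows "f \<circ>\<^sub>m g \<in> RM_fin"
proof -
  have f: "ri_morphism f" and g: "ri_morphism g" using assms by (auto simp: RM_fin_def)
  obtain M where M: "\<And>x. x \<in> dom f \<Longrightarrow> M \<le> length x \<Longrightarrow> take M x \<in> dom f"
    using assms(1) finite_domC_iff[OF f] by (auto simp: RM_fin_def)
  obtain N where N: "\<And>x. x \<in> dom g \<Longrightarrow> N \<le> length x \<Longrightarrow> take N x \<in> dom g"
    using assms(2) finite_domC_iff[OF g] by (auto simp: RM_fin_def)
  have "take (N + M) x \<in> dom (f \<circ>\<^sub>m g)"
    if x: "x \<in> dom (f \<circ>\<^sub>m g)" "N + M \<le> length x" for x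
  proof -
    have "x \<in> dom g" using x(1) by (auto simp: comp_dom_iff)
    then obtain y where y: "g (take N x) = Some y" using N[of x] x(2) by auto
    have gx: "g x = Some (y @ drop N x)"
      using ri_morphism_append[OF g y, of "drop N x"] by simp
    have gt: "g (take (N + M) x) = Some (y @ take M (drop N x))"
      using ri_morphism_append[OF g y, of "take M (drop N x)"] by (simp add: take_add)
    have "y @ drop N x \<in> dom f" using x gx by (auto simp: comp_dom_iff)
    then have "take M (y @ drop N x) \<in> dom f" by (rule M) (use x(2) in simp)
    moreover have "prefix (take M (y @ drop N x)) (y @ take M (drop N x))"
      by (rule prefix_length_prefix[of _ "y @ drop N x"])
        (auto simp: take_is_prefix simp del: take_append)
    ultimately have "y @ take M (drop N x) \<in> dom f" using ri_morphism_dom_prefix[OF f] by blast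
    then show ?thesis using gt by (auto simp: comp_dom_iff)
  qed
  then show ?thesis
    using finite_domC_iff[OF ri_morphism_comp[OF f g]] ri_morphism_comp[OF f g]
    by (auto simp: RM_fin_def)
qed

lemma Some_RM_fin: "Some \<in> RM_fin"
  using finite_domC_iff[OF ri_morphism_Some] ri_morphism_Some by (auto simp: RM_fin_def)

lemma plep_comp:
  assumes f: "plep f" and g: "plep g"
  shows "plep (f \<circ>\<^sub>m g)"
  unfolding plep_def
proof (intro ballI impI)
  fix x\<^sub>1 x\<^sub>2 :: str
  assume x: "x\<^sub>1 \<in> dom (f \<circ>\<^sub>m g)" "x\<^sub>2 \<in> dom (f \<circ>\<^sub>m g)" and len: "length x\<^sub>1 = length x\<^sub>2"
  obtain y\<^sub>1 y\<^sub>2 where y: "g x\<^sub>1 = Some y\<^sub>1" "y\<^sub>1 \<in> dom f" "g x\<^sub>2 = Some y\<^sub>2" "y\<^sub>2 \<in> dom f"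
    using x unfolding comp_dom_iff by blast
  then have "length y\<^sub>1 = length y\<^sub>2"
    using g len unfolding plep_def by (metis domI option.sel)
  then have "length (the (f y\<^sub>1)) = length (the (f y\<^sub>2))"
    using f y unfolding plep_def by blast
  then show "length (the ((f \<circ>\<^sub>m g) x\<^sub>1)) = length (the ((f \<circ>\<^sub>m g) x\<^sub>2))"
    using y by simp
qed

lemma total_comp:
  assumes f: "ri_morphism f" and g: "ri_morphism g" and "total_rim f" "total_rim g"
  shows "total_rim (f \<circ>\<^sub>m g)"
  unfolding total_rim_iff[OF ri_morphism_comp[OF f g]]
proof
  fix x
  obtain u y where u: "g (x @ u) = Some y" using assms total_rim_iff[OF g] by blast
  obtain v where v: "y @ v \<in> dom f" using assms total_rim_iff[OF f] by blast
  have "g ((x @ u) @ v) = Some (y @ v)" using ri_morphism_append[OF g u] .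
  then show "\<exists>u. x @ u \<in> dom (f \<circ>\<^sub>m g)" using v by (auto simp: comp_dom_iff)
qed

lemma pfl_comp:
  assumes f: "ri_morphism f" and g: "ri_morphism g" and "pfl f" "pfl g"
  shows "pfl (f \<circ>\<^sub>m g)"
proof -
  obtain m where m: "\<And>x. x \<in> dom f \<Longrightarrow> m \<le> length x \<and> take m x \<in> dom f"
    using \<open>pfl f\<close> unfolding pfl_def domC_fixed_length_iff[OF f] by blast
  obtain n where n: "\<And>x. x \<in> dom g \<Longrightarrow> n \<le> length x \<and> take n x \<in> dom g"
    using \<open>pfl g\<close> unfolding pfl_def domC_fixed_length_iff[OF g] by blast
  obtain k where k: "\<And>x y. g x = Some y \<Longrightarrow> length x = n \<Longrightarrow> length y = k"
  proof (cases "\<exists>x y. g x = Some y \<and> length x = n")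
    case True
    then obtain x y where xy: "g x = Some y" "length x = n" by blast
    show ?thesis
    proof (rule that[of "length y"])
      fix x' y' assume "g x' = Some y'" "length x' = n"
      then show "length y' = length y"
        using xy \<open>pfl g\<close> unfolding pfl_def plep_def by (metis domI option.sel)
    qed
  qed (use that in blast)
  define M where "M = n + (m - k)"
  have "M \<le> length x \<and> take M x \<in> dom (f \<circ>\<^sub>m g)" if x: "x \<in> dom (f \<circ>\<^sub>m g)" for x
  proof -
    have nx: "n \<le> length x" "take n x \<in> dom g"
      using x n[of x] by (auto simp: comp_dom_iff)
    then obtain y where y: "g (take n x) = Some y" by auto
    have ly: "length y = k" using k[OF y] nx by simp
    have gx: "g x = Some (y @ drop n x)"
      using ri_morphism_append[OF g y, of "drop n x"] by simp
    have gt: "g (take M x) = Some (y @ take (m - k) (drop n x))"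
      using ri_morphism_append[OF g y, of "take (m - k) (drop n x)"]
      by (simp add: take_add M_def)
    have d: "m \<le> length (y @ drop n x)" "take m (y @ drop n x) \<in> dom f"
    proof -
      have "y @ drop n x \<in> dom f" using x gx by (auto simp: comp_dom_iff)
      then show "m \<le> length (y @ drop n x)" "take m (y @ drop n x) \<in> dom f" using m by blast+
    qed
    have "prefix (take m (y @ drop n x)) (y @ take (m - k) (drop n x))"
      by (rule prefix_length_prefix[of _ "y @ drop n x"])
        (use ly in \<open>auto simp: take_is_prefix simp del: take_append\<close>)
    then have "y @ take (m - k) (drop n x) \<in> dom f"
      using d(2) ri_morphism_dom_prefix[OF f] by blast
    then show ?thesis using gt d(1) ly nx by (auto simp: comp_dom_iff M_def)
  qed
  then show ?thesis
    using domC_fixed_length_iff[OF ri_morphism_comp[OF f g]] plep_comp assms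
    by (auto simp: pfl_def)
qed

lemma props_Some: "plep Some" "total_rim Some" "pfl Some"
proof -
  show "plep Some" by (simp add: plep_def)
  then show "pfl Some"
    unfolding pfl_def domC_fixed_length_iff[OF ri_morphism_Some] by (auto intro: exI[of _ 0])
  show "total_rim Some" by (simp add: total_rim_iff[OF ri_morphism_Some])
qed

lemma map_comp_assoc: "(f \<circ>\<^sub>m g) \<circ>\<^sub>m h = f \<circ>\<^sub>m (g \<circ>\<^sub>m h)"
  by (rule ext) (simp add: map_comp_def split: option.splits)

lemma monoid_RM_monoid:
  assumes "P Some"
    and "\<And>f g. \<lbrakk>f \<in> RM_fin; g \<in> RM_fin; P f; P g\<rbrakk> \<Longrightarrow> P (f \<circ>\<^sub>m g)"
  shows "monoid (RM_monoid P)"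
proof (rule monoidI)
  fix f assume "f \<in> carrier (RM_monoid P)"
  show "\<one>\<^bsub>RM_monoid P\<^esub> \<otimes>\<^bsub>RM_monoid P\<^esub> f = f" "f \<otimes>\<^bsub>RM_monoid P\<^esub> \<one>\<^bsub>RM_monoid P\<^esub> = f"
    by (rule ext, simp add: RM_monoid_def map_comp_def split: option.splits)+
qed (use assms in \<open>auto simp: RM_monoid_def RM_fin_comp Some_RM_fin map_comp_assoc\<close>)

lemma RM_fin_morphism: "f \<in> RM_fin \<Longrightarrow> ri_morphism f"
  by (simp add: RM_fin_def)

lemma monoid_RM2fin: "monoid RM2fin"
  unfolding RM2fin_def by (rule monoid_RM_monoid) auto

lemma monoid_plepRM: "monoid plepRM"
  unfolding plepRM_def by (rule monoid_RM_monoid) (auto simp: props_Some plep_comp)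

lemma monoid_tlepRM: "monoid tlepRM"
  unfolding tlepRM_def
  by (rule monoid_RM_monoid) (auto simp: tlep_def props_Some plep_comp total_comp RM_fin_morphism)

lemma monoid_pflRM: "monoid pflRM"
  unfolding pflRM_def
  by (rule monoid_RM_monoid) (auto simp: props_Some pfl_comp RM_fin_morphism)

lemma monoid_tflRM: "monoid tflRM"
  unfolding tflRM_def
  by (rule monoid_RM_monoid)
    (auto simp: tfl_iff ri_morphism_Some props_Some pfl_comp total_comp RM_fin_morphism
      ri_morphism_comp)

lemma submonoid_RM_monoid:
  assumes "monoid (RM_monoid P)"
  shows "submonoid (carrier (RM_monoid P)) RM2fin"
proof
  show "carrier (RM_monoid P) \<subseteq> carrier RM2fin" by (auto simp: RM2fin_def RM_monoid_def)
  show "\<one>\<^bsub>RM2fin\<^esub> \<in> carrier (RM_monoid P)"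
    using monoid.one_closed[OF assms] by (simp add: RM2fin_def RM_monoid_def)
  fix f g assume "f \<in> carrier (RM_monoid P)" "g \<in> carrier (RM_monoid P)"
  from monoid.m_closed[OF assms this] show "f \<otimes>\<^bsub>RM2fin\<^esub> g \<in> carrier (RM_monoid P)"
    by (simp add: RM2fin_def RM_monoid_def)
qed

lemma submonoids_RM2fin:
  "submonoid (carrier plepRM) RM2fin" "submonoid (carrier tlepRM) RM2fin"
  "submonoid (carrier pflRM) RM2fin" "submonoid (carrier tflRM) RM2fin"
  using monoid_plepRM monoid_tlepRM monoid_pflRM monoid_tflRM
  unfolding plepRM_def tlepRM_def pflRM_def tflRM_def by (auto intro: submonoid_RM_monoid)


subsection \<open>The congruence\<close>

lemma fin_equiv_trans:
  assumes f: "ri_morphism f" and g: "ri_morphism g" and h: "ri_morphism h"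
    and fg: "fin_equiv f g" and gh: "fin_equiv g h"
  shows "fin_equiv f h"
proof -
  have fin: "finite (dom f - dom g)" "finite (dom g - dom f)"
    "finite (dom g - dom h)" "finite (dom h - dom g)"
    using fg gh by (auto simp: fin_equiv_def)
  have "(dom f - dom h) \<union> (dom h - dom f) \<subseteq>
      (dom f - dom g) \<union> (dom g - dom f) \<union> (dom g - dom h) \<union> (dom h - dom g)"
    by blast
  then have 1: "finite ((dom f - dom h) \<union> (dom h - dom f))"
    by (rule finite_subset) (use fin in blast)
  have "f x = h x" if x: "x \<in> dom f \<inter> dom h" for x
  proof -
    obtain a b where ab: "f x = Some a" "h x = Some b" using x by blast
    have inj: "inj (\<lambda>n. x @ replicate n True)"
      by (rule injI) (metis append_same_eq length_replicate same_append_eq)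
    have "\<not> range (\<lambda>n. x @ replicate n True) \<subseteq> dom f - dom g"
      using fin(1) finite_imageD[OF _ inj] infinite_UNIV_nat finite_subset by blast
    then obtain n where n: "x @ replicate n True \<in> dom g"
      using ri_morphism_append[OF f ab(1)] by blast
    let ?x = "x @ replicate n True"
    have fh: "f ?x = Some (a @ replicate n True)" "h ?x = Some (b @ replicate n True)"
      using ri_morphism_append[OF f ab(1)] ri_morphism_append[OF h ab(2)] by auto
    have "f ?x = g ?x" "g ?x = h ?x"
      using fg gh n fh unfolding fin_equiv_def by blast+
    then show ?thesis using fh ab by simp
  qed
  then show ?thesis unfolding fin_equiv_def using 1 by blast
qed

lemma finite_dom_diff_comp:
  assumes g: "g \<in> RM_fin"
    and df: "finite (dom f - dom f')" and dg: "finite (dom g - dom g')"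
    and ag: "\<And>x. x \<in> dom g \<inter> dom g' \<Longrightarrow> g x = g' x"
  shows "finite (dom (f \<circ>\<^sub>m g) - dom (f' \<circ>\<^sub>m g'))"
proof -
  have gm: "ri_morphism g" using g by (rule RM_fin_morphism)
  obtain N where N: "\<And>x. x \<in> dom g \<Longrightarrow> N \<le> length x \<Longrightarrow> take N x \<in> dom g"
    using g finite_domC_iff[OF gm] by (auto simp: RM_fin_def)
  define L where "L = Max (insert 0 (length ` (dom f - dom f')))"
  have "length x \<le> N + L" if x: "g x = Some y" "y \<in> dom f - dom f'" for x y
  proof (cases "N \<le> length x")
    case True
    then obtain z where "g (take N x) = Some z" using N[of x] x by auto
    from ri_morphism_append[OF gm this, of "drop N x"] x have "y = z @ drop N x" by simp
    moreover have "length y \<le> L" using x(2) df by (auto simp: L_def)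
    ultimately show ?thesis using True by simp
  qed simp
  note bound = this
  have "dom (f \<circ>\<^sub>m g) - dom (f' \<circ>\<^sub>m g') \<subseteq> (dom g - dom g') \<union> {x. length x \<le> N + L}"
  proof
    fix x assume x: "x \<in> dom (f \<circ>\<^sub>m g) - dom (f' \<circ>\<^sub>m g')"
    then obtain y where y: "g x = Some y" "y \<in> dom f" unfolding Diff_iff comp_dom_iff by blast
    show "x \<in> (dom g - dom g') \<union> {x. length x \<le> N + L}"
    proof (cases "x \<in> dom g'")
      case True
      then have "g' x = Some y" using ag[of x] domI[of g x y] y(1) True by simp
      then have "y \<notin> dom f'" using x unfolding Diff_iff comp_dom_iff by blast
      then show ?thesis using bound[of x y] y by blast
    qed (use y in blast)
  qed
  then show ?thesis
    by (rule finite_subset) (use dg finite_bounded_strings in blast)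
qed

lemma fin_equiv_comp:
  assumes "f \<in> RM_fin" "f' \<in> RM_fin" "g \<in> RM_fin" "g' \<in> RM_fin"
    and "fin_equiv f f'" "fin_equiv g g'"
  shows "fin_equiv (f \<circ>\<^sub>m g) (f' \<circ>\<^sub>m g')"
proof -
  have "finite (dom (f \<circ>\<^sub>m g) - dom (f' \<circ>\<^sub>m g'))" "finite (dom (f' \<circ>\<^sub>m g') - dom (f \<circ>\<^sub>m g))"
    using assms finite_dom_diff_comp[of g f f' g'] finite_dom_diff_comp[of g' f' f g]
    by (auto simp: fin_equiv_def)
  moreover have "(f \<circ>\<^sub>m g) x = (f' \<circ>\<^sub>m g') x"
    if x: "x \<in> dom (f \<circ>\<^sub>m g) \<inter> dom (f' \<circ>\<^sub>m g')" for x
  proof -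
    obtain y y' where y: "g x = Some y" "y \<in> dom f" "g' x = Some y'" "y' \<in> dom f'"
      using x by (auto simp only: Int_iff comp_dom_iff)
    then have "g x = g' x" using assms(6) unfolding fin_equiv_def by blast
    then have "y = y'" using y by simp
    then have "f y = f' y'" using assms(5) y unfolding fin_equiv_def by blast
    then show ?thesis using y by simp
  qed
  ultimately show ?thesis by (simp add: fin_equiv_def)
qed

lemma quotient_mult:
  assumes "equiv (carrier M) r"
    and "\<And>a a' b b'. (a, a') \<in> r \<Longrightarrow> (b, b') \<in> r \<Longrightarrow> (a \<otimes>\<^bsub>M\<^esub> b, a' \<otimes>\<^bsub>M\<^esub> b') \<in> r"
    and "a \<in> carrier M" "b \<in> carrier M"
  shows "r `` {a} \<otimes>\<^bsub>quotient_monoid M r\<^esub> r `` {b} = r `` {a \<otimes>\<^bsub>M\<^esub> b}"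
proof -
  have 1: "r `` {a' \<otimes>\<^bsub>M\<^esub> b'} = r `` {a \<otimes>\<^bsub>M\<^esub> b}"
    if "a' \<in> r `` {a}" "b' \<in> r `` {b}" for a' b'
  proof -
    have "(a \<otimes>\<^bsub>M\<^esub> b, a' \<otimes>\<^bsub>M\<^esub> b') \<in> r" using that by (intro assms(2)) auto
    then show ?thesis by (simp add: equiv_class_eq[OF assms(1)])
  qed
  have 2: "a \<in> r `` {a}" "b \<in> r `` {b}"
    using assms(3,4) equiv_class_self[OF assms(1)] by simp_all
  have 3: "(\<Union>x\<in>A. \<Union>y\<in>B. F x y) = C"
    if "\<And>x y. x \<in> A \<Longrightarrow> y \<in> B \<Longrightarrow> F x y = C" "a \<in> A" "b \<in> B"
    for A B :: "'a set" and F and C :: "'a set"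
    using that by blast
  show ?thesis unfolding quotient_monoid_def monoid.simps by (rule 3[OF 1 2])
qed

lemma monoid_quotient_monoid:
  assumes "monoid M" and eq: "equiv (carrier M) r"
    and cong: "\<And>a a' b b'. (a, a') \<in> r \<Longrightarrow> (b, b') \<in> r \<Longrightarrow> (a \<otimes>\<^bsub>M\<^esub> b, a' \<otimes>\<^bsub>M\<^esub> b') \<in> r"
  shows "monoid (quotient_monoid M r)"
proof -
  interpret M: monoid M by fact
  let ?Q = "quotient_monoid M r"
  note mult = quotient_mult[OF eq cong]
  have car: "carrier ?Q = carrier M // r" and one: "\<one>\<^bsub>?Q\<^esub> = r `` {\<one>\<^bsub>M\<^esub>}"
    by (simp_all add: quotient_monoid_def)
  show ?thesis
  proof (rule monoidI)
    fix A B assume "A \<in> carrier ?Q" "B \<in> carrier ?Q"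
    then obtain a b where "A = r `` {a}" "a \<in> carrier M" "B = r `` {b}" "b \<in> carrier M"
      unfolding car by (metis quotientE)
    then show "A \<otimes>\<^bsub>?Q\<^esub> B \<in> carrier ?Q" by (simp add: mult car quotientI)
  next
    fix A B C assume "A \<in> carrier ?Q" "B \<in> carrier ?Q" "C \<in> carrier ?Q"
    then obtain a b c where "A = r `` {a}" "a \<in> carrier M" "B = r `` {b}" "b \<in> carrier M"
      "C = r `` {c}" "c \<in> carrier M"
      unfolding car by (metis quotientE)
    then show "A \<otimes>\<^bsub>?Q\<^esub> B \<otimes>\<^bsub>?Q\<^esub> C = A \<otimes>\<^bsub>?Q\<^esub> (B \<otimes>\<^bsub>?Q\<^esub> C)"
      by (simp add: mult M.m_assoc)
  next
    show "\<one>\<^bsub>?Q\<^esub> \<in> carrier ?Q" by (simp add: car one quotientI)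
  next
    fix A assume "A \<in> carrier ?Q"
    then obtain a where "A = r `` {a}" "a \<in> carrier M" unfolding car by (metis quotientE)
    then show "\<one>\<^bsub>?Q\<^esub> \<otimes>\<^bsub>?Q\<^esub> A = A" "A \<otimes>\<^bsub>?Q\<^esub> \<one>\<^bsub>?Q\<^esub> = A"
      by (simp_all add: one mult)
  qed
qed

lemma monoid_mod_fin_equiv:
  assumes "monoid (RM_monoid P)"
  shows "monoid (mod_fin_equiv (RM_monoid P))"
  unfolding mod_fin_equiv_def
proof (rule monoid_quotient_monoid[OF assms])
  let ?M = "RM_monoid P"
  let ?r = "{(f, g). f \<in> carrier ?M \<and> g \<in> carrier ?M \<and> fin_equiv f g}"
  have car: "f \<in> carrier ?M \<Longrightarrow> f \<in> RM_fin" for f by (auto simp: RM_monoid_def)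
  show "equiv (carrier ?M) ?r"
  proof (rule equivI)
    show "?r \<subseteq> carrier ?M \<times> carrier ?M" by auto
    show "refl_on (carrier ?M) ?r" by (auto simp: refl_on_def fin_equiv_def)
    show "sym ?r" by (auto simp: sym_def fin_equiv_def)
    show "trans ?r"
      unfolding trans_def using fin_equiv_trans car RM_fin_morphism by blast
  qed
  have mult: "f \<otimes>\<^bsub>?M\<^esub> g = f \<circ>\<^sub>m g" for f g by (simp add: RM_monoid_def)
  fix f f' g g' assume "(f, f') \<in> ?r" "(g, g') \<in> ?r"
  then have c: "f \<in> carrier ?M" "f' \<in> carrier ?M" "g \<in> carrier ?M" "g' \<in> carrier ?M"
    and e: "fin_equiv f f'" "fin_equiv g g'" by simp_all
  have "fin_equiv (f \<otimes>\<^bsub>?M\<^esub> g) (f' \<otimes>\<^bsub>?M\<^esub> g')"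
    unfolding mult using c[THEN car] e by (rule fin_equiv_comp)
  then show "(f \<otimes>\<^bsub>?M\<^esub> g, f' \<otimes>\<^bsub>?M\<^esub> g') \<in> ?r"
    using c monoid.m_closed[OF assms] by simp
qed

lemma monoid_quotients: "monoid plepM" "monoid tlepM" "monoid pflM" "monoid tflM"
  using monoid_plepRM monoid_tlepRM monoid_pflRM monoid_tflRM
  unfolding plepM_def tlepM_def pflM_def tflM_def plepRM_def tlepRM_def pflRM_def tflRM_def
  by (auto intro: monoid_mod_fin_equiv)

end

theory Submission
  imports Defs
begin

text \<open>
  Fix a finite set \<open>S\<close> of generators. Since each of them has a finite domain code, there is a
  single \<open>N\<close> such that every generator inspects and rewrites only the first \<open>N\<close> letters of its
  argument and copies the remaining letters behind its output. A product of generators can alter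
  letters deeper than \<open>N\<close> only if some intermediate product has first moved them closer to the
  front, that is, if it shortens long inputs.

  Counting excludes this whenever the whole product is defined and injective on all
  words of each large length. Every initial part \<open>k\<close> of such a product is again defined and
  injective on these words, and being plep it maps the \<open>2\<^sup>n\<close> words of length \<open>n\<close> injectively
  into the words of one single length; so that length is at least \<open>n\<close>
  (\<open>length_le_of_eventually_injective\<close>). Hence the letters after position \<open>N\<close> are never changed
  (\<open>keeps_tail_comp\<close>), and the map that negates the letter at index \<open>N\<close> is not a product of
  generators.

  That map is tfl, so it lies in all the monoids in question. The argument looks at
  long inputs only, so it excludes even products that are \<open>fin_equiv\<close> to the negation map; this
  settles the quotients together with the monoids themselves.
\<close>


section \<open>Injectivity on long words and untouched tails\<close>

definition reads_within :: "nat \<Rightarrow> (str \<rightharpoonup> str) \<Rightarrow> bool" where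
  "reads_within N s \<longleftrightarrow> (\<forall>x\<in>dom s. N \<le> length x \<longrightarrow> take N x \<in> dom s)"

definition eventually_injective :: "(str \<rightharpoonup> str) \<Rightarrow> bool" where
  "eventually_injective k \<longleftrightarrow>
     (\<exists>L. \<forall>n\<ge>L. strings_of_length n \<subseteq> dom k \<and> inj_on k (strings_of_length n))"

text \<open>The word \<open>y\<close> may depend on all of \<open>x\<close>, not only on its first \<open>N\<close> letters: only the position
  and the content of the tail matter. The bound \<open>N \<le> length y\<close> says that the tail has not come
  within reach of a map that reads \<open>N\<close> letters.\<close>

definition keeps_tail :: "nat \<Rightarrow> (str \<rightharpoonup> str) \<Rightarrow> bool" where
  "keeps_tail N h \<longleftrightarrow>
     (\<exists>L. \<forall>x. L \<le> length x \<longrightarrow> (\<exists>y. N \<le> length y \<and> h x = Some (y @ drop N x)))"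

lemma reads_within_mono:
  assumes "ri_morphism s" "reads_within M s" "M \<le> N"
  shows "reads_within N s"
  unfolding reads_within_def
proof (intro ballI impI)
  fix x assume x: "x \<in> dom s" "N \<le> length x"
  then have "take M x \<in> dom s" using assms by (auto simp: reads_within_def)
  moreover have "prefix (take M x) (take N x)"
    using assms(3) by (metis min.absorb1 take_is_prefix take_take)
  ultimately show "take N x \<in> dom s" using ri_morphism_dom_prefix[OF assms(1)] by blast
qed

lemma finite_uniform_reads_within:
  assumes "finite S" "S \<subseteq> RM_fin"
  obtains N where "\<And>s. s \<in> S \<Longrightarrow> reads_within N s"
proof -
  have "\<forall>s\<in>S. \<exists>N. reads_within N s"
    using assms(2) finite_domC_iff unfolding reads_within_def RM_fin_def by blast
  then obtain b where b: "\<And>s. s \<in> S \<Longrightarrow> reads_within (b s) s" by metis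
  have "reads_within (Max (b ` S)) s" if "s \<in> S" for s
    by (rule reads_within_mono[OF _ b[OF that]]) (use assms that in \<open>auto simp: RM_fin_def\<close>)
  then show ?thesis by (rule that)
qed

lemma eventually_injective_right_factor:
  assumes "eventually_injective (g \<circ>\<^sub>m h)"
  shows "eventually_injective h"
proof -
  obtain L where L: "\<And>n. L \<le> n \<Longrightarrow>
      strings_of_length n \<subseteq> dom (g \<circ>\<^sub>m h) \<and> inj_on (g \<circ>\<^sub>m h) (strings_of_length n)"
    using assms unfolding eventually_injective_def by blast
  have "strings_of_length n \<subseteq> dom h \<and> inj_on h (strings_of_length n)" if "L \<le> n" for n
  proof
    show "strings_of_length n \<subseteq> dom h"
    proof
      fix x assume "x \<in> strings_of_length n"
      then have "x \<in> dom (g \<circ>\<^sub>m h)" using L[OF that] by blast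
      then show "x \<in> dom h" unfolding comp_dom_iff by blast
    qed
    show "inj_on h (strings_of_length n)"
    proof (rule inj_onI)
      fix x y
      assume xy: "x \<in> strings_of_length n" "y \<in> strings_of_length n" and "h x = h y"
      then have "(g \<circ>\<^sub>m h) x = (g \<circ>\<^sub>m h) y" by (simp add: map_comp_def)
      then show "x = y" using L[OF that] xy by (auto dest: inj_onD)
    qed
  qed
  then show ?thesis unfolding eventually_injective_def by blast
qed

lemma card_strings_of_length: "card (strings_of_length n) = 2 ^ n"
  using card_lists_length_eq[of "UNIV :: bool set" n] by (simp add: strings_of_length_def)

lemma finite_strings_of_length: "finite (strings_of_length n)"
  using finite_lists_length_eq[of "UNIV :: bool set" n] by (simp add: strings_of_length_def)

text \<open>Length-equality preservation is what makes counting possible: all words of length \<open>n\<close> land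
  in the words of a single length \<open>m\<close>, whence \<open>2\<^sup>n \<le> 2\<^sup>m\<close>. Without it, injectivity
  would still let individual words become shorter.\<close>

lemma length_le_of_eventually_injective:
  assumes "plep k" "eventually_injective k"
  obtains L where "\<And>x y. L \<le> length x \<Longrightarrow> k x = Some y \<Longrightarrow> length x \<le> length y"
proof -
  obtain L where L: "\<And>n. L \<le> n \<Longrightarrow>
      strings_of_length n \<subseteq> dom k \<and> inj_on k (strings_of_length n)"
    using assms(2) unfolding eventually_injective_def by blast
  have "length x \<le> length y" if x: "L \<le> length x" "k x = Some y" for x y
  proof -
    let ?A = "strings_of_length (length x)"
    have sub: "k ` ?A \<subseteq> Some ` strings_of_length (length y)"
    proof
      fix w assume "w \<in> k ` ?A"
      then obtain x' where x': "length x' = length x" "k x' = w"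
        by (auto simp: strings_of_length_def)
      then have "x' \<in> dom k" using L[OF x(1)] by (auto simp: strings_of_length_def)
      then obtain y' where y': "w = Some y'" using x'(2) by auto
      have "length y' = length y"
        using assms(1) x' y' x(2) unfolding plep_def by (metis domI option.sel)
      then show "w \<in> Some ` strings_of_length (length y)"
        using y' by (simp add: strings_of_length_def)
    qed
    have "card ?A \<le> card (Some ` strings_of_length (length y))"
      using L[OF x(1)] sub by (intro card_inj_on_le[of k]) (auto simp: finite_strings_of_length)
    then show ?thesis by (simp add: card_image card_strings_of_length)
  qed
  then show ?thesis by (rule that)
qed

text \<open>While the tail starts at position \<open>N\<close> or later, \<open>s\<close> cannot touch it; the
  length bound for the eventually injective composition ensures that \<open>s\<close> does not bring it
  closer than \<open>N\<close> either.\<close>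

lemma keeps_tail_comp:
  assumes s: "ri_morphism s" "reads_within N s"
    and h: "keeps_tail N h"
    and sh: "plep (s \<circ>\<^sub>m h)" "eventually_injective (s \<circ>\<^sub>m h)"
  shows "keeps_tail N (s \<circ>\<^sub>m h)"
proof -
  obtain L1 where L1: "\<And>x. L1 \<le> length x \<Longrightarrow> \<exists>y. N \<le> length y \<and> h x = Some (y @ drop N x)"
    using h unfolding keeps_tail_def by blast
  obtain L2 where L2: "\<And>x y. L2 \<le> length x \<Longrightarrow> (s \<circ>\<^sub>m h) x = Some y \<Longrightarrow> length x \<le> length y"
    using length_le_of_eventually_injective[OF sh] by blast
  obtain L3 where L3: "\<And>n. L3 \<le> n \<Longrightarrow> strings_of_length n \<subseteq> dom (s \<circ>\<^sub>m h)"
    using sh(2) unfolding eventually_injective_def by blast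
  have "\<exists>y. N \<le> length y \<and> (s \<circ>\<^sub>m h) x = Some (y @ drop N x)"
    if x: "N + L1 + L2 + L3 \<le> length x" for x
  proof -
    obtain y where y: "N \<le> length y" "h x = Some (y @ drop N x)" using L1[of x] x by auto
    have "x \<in> dom (s \<circ>\<^sub>m h)" using L3[of "length x"] x by (auto simp: strings_of_length_def)
    then have "y @ drop N x \<in> dom s" using y(2) by (auto simp: comp_dom_iff)
    then have "take N (y @ drop N x) \<in> dom s"
      using y(1) by (intro s(2)[unfolded reads_within_def, rule_format]) simp_all
    then obtain z where z: "s (take N y) = Some z" using y(1) by auto
    have "s (take N y @ (drop N y @ drop N x)) = Some (z @ (drop N y @ drop N x))"
      using z by (rule ri_morphism_append[OF s(1)])
    then have eq: "(s \<circ>\<^sub>m h) x = Some ((z @ drop N y) @ drop N x)"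
      using y(2) by (simp flip: append_assoc)
    have "length x \<le> length ((z @ drop N y) @ drop N x)" using L2[OF _ eq] x by simp
    then have "N \<le> length (z @ drop N y)" using x by simp
    then show ?thesis using eq by blast
  qed
  then show ?thesis unfolding keeps_tail_def by blast
qed

text \<open>Elements of the generated submonoid are arbitrarily bracketed products. Quantifying over
  all maps \<open>h\<close> applied beforehand turns the step-by-step argument into a property of \<open>g\<close> that is
  closed under composition: in \<open>g\<^sub>1 \<circ>\<^sub>m g\<^sub>2 \<circ>\<^sub>m h\<close> the right factor \<open>g\<^sub>2 \<circ>\<^sub>m h\<close> inherits eventual
  injectivity.\<close>

lemma generated_keeps_tail:
  assumes P: "\<And>f. P f \<Longrightarrow> plep f"
    and S: "S \<subseteq> carrier (RM_monoid P)" "\<And>s. s \<in> S \<Longrightarrow> reads_within N s"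
    and g: "g \<in> generated_submonoid (RM_monoid P) S"
    and h: "plep h" "keeps_tail N h" "eventually_injective (g \<circ>\<^sub>m h)"
  shows "plep (g \<circ>\<^sub>m h) \<and> keeps_tail N (g \<circ>\<^sub>m h)"
  using g h
proof (induction arbitrary: h)
  case one
  have "Some \<circ>\<^sub>m h = h" by (rule ext) (simp add: map_comp_def split: option.splits)
  then show ?case using one by (simp add: RM_monoid_def)
next
  case (incl s)
  then have s: "ri_morphism s" "plep s" "reads_within N s"
    using S P by (auto simp: RM_monoid_def RM_fin_def)
  have "plep (s \<circ>\<^sub>m h)" using s(2) incl(2) by (rule plep_comp)
  then show ?case using keeps_tail_comp[OF s(1,3)] incl by blast
next
  case (mult g1 g2)
  have eq: "g1 \<otimes>\<^bsub>RM_monoid P\<^esub> g2 \<circ>\<^sub>m h = g1 \<circ>\<^sub>m (g2 \<circ>\<^sub>m h)"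
    by (simp add: RM_monoid_def map_comp_assoc)
  have inj: "eventually_injective (g1 \<circ>\<^sub>m (g2 \<circ>\<^sub>m h))" using mult.prems(3) unfolding eq .
  show ?case
    unfolding eq
    using mult.IH mult.prems(1,2) inj eventually_injective_right_factor[OF inj] by blast
qed


section \<open>Negating one letter\<close>

definition negate_at :: "nat \<Rightarrow> str \<rightharpoonup> str" where
  "negate_at N x = (if N < length x then Some (x[N := \<not> x ! N]) else None)"

lemma dom_negate_at: "x \<in> dom (negate_at N) \<longleftrightarrow> N < length x"
  by (simp add: negate_at_def dom_def)

lemma ri_morphism_negate_at: "ri_morphism (negate_at N)"
  by (rule ri_morphismI)
    (auto simp: negate_at_def list_update_append nth_append split: if_splits)

lemma negate_at_RM_fin: "negate_at N \<in> RM_fin"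
  unfolding RM_fin_def mem_Collect_eq finite_domC_iff[OF ri_morphism_negate_at] dom_negate_at
  by (auto intro!: ri_morphism_negate_at exI[of _ "Suc N"])

lemma tfl_negate_at: "tfl (negate_at N)"
proof -
  have "plep (negate_at N)" by (auto simp: plep_def dom_negate_at negate_at_def)
  moreover have "domC (negate_at N) \<subseteq> strings_of_length (Suc N)"
    by (auto simp: domC_fixed_length_iff[OF ri_morphism_negate_at] dom_negate_at)
  moreover have "\<exists>u. x @ u \<in> dom (negate_at N)" for x
    unfolding dom_negate_at by (rule exI[of _ "replicate (Suc N) True"]) simp
  ultimately show ?thesis
    unfolding tfl_iff[OF ri_morphism_negate_at] pfl_def total_rim_iff[OF ri_morphism_negate_at]
    by blast
qed

lemma negate_at_involution:
  "negate_at N x = Some y \<Longrightarrow> negate_at N y = Some x"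
  by (auto simp: negate_at_def split: if_splits)

lemma fin_equiv_negate_at_eventually_eq:
  assumes "fin_equiv (negate_at N) g"
  obtains L where "N < L" "\<And>x. L \<le> length x \<Longrightarrow> g x = negate_at N x"
proof -
  have fin: "finite (dom (negate_at N) - dom g)" using assms by (simp add: fin_equiv_def)
  define b where "b = Max (insert 0 (length ` (dom (negate_at N) - dom g)))"
  have "g x = negate_at N x" if x: "Suc (N + b) \<le> length x" for x
  proof -
    have x1: "x \<in> dom (negate_at N)" using x by (simp add: dom_negate_at)
    have "x \<in> dom g"
    proof (rule ccontr)
      assume "x \<notin> dom g"
      then have "length x \<le> b" using x1 fin unfolding b_def by (intro Max_ge) auto
      then show False using x by simp
    qed
    then show ?thesis using assms x1 unfolding fin_equiv_def by (metis IntI)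
  qed
  then show ?thesis by (intro that[of "Suc (N + b)"]) auto
qed

lemma fin_equiv_negate_at_eventually_injective:
  assumes "fin_equiv (negate_at N) g"
  shows "eventually_injective g"
proof -
  obtain L where L: "N < L" "\<And>x. L \<le> length x \<Longrightarrow> g x = negate_at N x"
    using fin_equiv_negate_at_eventually_eq[OF assms] by blast
  have "strings_of_length n \<subseteq> dom g \<and> inj_on g (strings_of_length n)" if n: "L \<le> n" for n
  proof
    have g: "g x = negate_at N x" "N < length x" if "x \<in> strings_of_length n" for x
      using that n L by (auto simp: strings_of_length_def)
    show "strings_of_length n \<subseteq> dom g"
      using g by (metis dom_negate_at domIff subsetI)
    show "inj_on g (strings_of_length n)"
    proof (rule inj_onI)
      fix x y assume xy: "x \<in> strings_of_length n" "y \<in> strings_of_length n" "g x = g y"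
      obtain z where "negate_at N x = Some z" using g[OF xy(1)] by (simp add: negate_at_def)
      moreover from this have "negate_at N y = Some z" using g xy by metis
      ultimately show "x = y" by (metis negate_at_involution option.inject)
    qed
  qed
  then show ?thesis unfolding eventually_injective_def by blast
qed

lemma fin_equiv_negate_at_not_keeps_tail:
  assumes "fin_equiv (negate_at N) g"
  shows "\<not> keeps_tail N g"
proof
  assume "keeps_tail N g"
  then obtain L1 where L1: "\<And>x. L1 \<le> length x \<Longrightarrow> \<exists>y. N \<le> length y \<and> g x = Some (y @ drop N x)"
    unfolding keeps_tail_def by blast
  obtain L2 where L2: "N < L2" "\<And>x. L2 \<le> length x \<Longrightarrow> g x = negate_at N x"
    using fin_equiv_negate_at_eventually_eq[OF assms] by blast
  define x where "x = replicate (L1 + L2) True"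
  have x: "L1 \<le> length x" "L2 \<le> length x" "N < length x" using L2(1) by (simp_all add: x_def)
  obtain y where y: "N \<le> length y" "g x = Some (y @ drop N x)" using L1[OF x(1)] by blast
  have eq: "x[N := \<not> x ! N] = y @ drop N x"
    using y(2) L2(2)[OF x(2)] x(3) by (simp add: negate_at_def)
  \<comment> \<open>Negation preserves the length, so the tail is in its original place and still contains the
    letter at index \<open>N\<close> in its original form.\<close>
  have "length x = length y + (length x - N)" using arg_cong[OF eq, of length] by simp
  then have "length y = N" using y(1) x(3) by simp
  then have "(y @ drop N x) ! N = x ! N" using x(3) by (simp add: nth_append)
  moreover have "x[N := \<not> x ! N] ! N = (\<not> x ! N)" using x(3) by simp
  ultimately show False using eq by simp
qed


section \<open>Monoids of plep morphisms containing all tfl morphisms\<close>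

lemma negate_at_not_generated:
  assumes P: "\<And>f. P f \<Longrightarrow> plep f"
    and S: "finite S" "S \<subseteq> carrier (RM_monoid P)"
  obtains N where
    "\<And>g. g \<in> generated_submonoid (RM_monoid P) S \<Longrightarrow> \<not> fin_equiv (negate_at N) g"
proof -
  have "S \<subseteq> RM_fin" using S(2) by (auto simp: RM_monoid_def)
  then obtain N where N: "\<And>s. s \<in> S \<Longrightarrow> reads_within N s"
    using finite_uniform_reads_within[OF S(1)] by blast
  have "\<not> fin_equiv (negate_at N) g"
    if g: "g \<in> generated_submonoid (RM_monoid P) S" for g
  proof
    assume eq: "fin_equiv (negate_at N) g"
    have Some: "g \<circ>\<^sub>m Some = g" by (rule ext) simp
    have "keeps_tail N Some"
      unfolding keeps_tail_def
    proof (intro exI allI impI conjI)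
      fix x :: str assume "N \<le> length x"
      then show "N \<le> length (take N x)" by simp
      show "Some x = Some (take N x @ drop N x)" by simp
    qed
    moreover have "eventually_injective (g \<circ>\<^sub>m Some)"
      unfolding Some using eq by (rule fin_equiv_negate_at_eventually_injective)
    ultimately have "keeps_tail N (g \<circ>\<^sub>m Some)"
      using generated_keeps_tail[OF P S(2) N g props_Some(1)] by blast
    then show False using fin_equiv_negate_at_not_keeps_tail[OF eq] by (simp add: Some)
  qed
  then show ?thesis by (rule that)
qed

lemma fin_equiv_refl: "fin_equiv f f"
  by (simp add: fin_equiv_def)

lemma not_finitely_generated_RM_monoid:
  assumes P: "\<And>f. P f \<Longrightarrow> plep f" and tfl: "\<And>f. tfl f \<Longrightarrow> P f"
  shows "\<not> finitely_generated_monoid (RM_monoid P)"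
proof
  assume "finitely_generated_monoid (RM_monoid P)"
  then obtain S where S: "finite S" "S \<subseteq> carrier (RM_monoid P)"
    and gen: "generated_submonoid (RM_monoid P) S = carrier (RM_monoid P)"
    unfolding finitely_generated_monoid_def by blast
  obtain N where N: "\<And>g. g \<in> carrier (RM_monoid P) \<Longrightarrow> \<not> fin_equiv (negate_at N) g"
    using negate_at_not_generated[OF P S] unfolding gen by blast
  have "negate_at N \<in> carrier (RM_monoid P)"
    using tfl[OF tfl_negate_at] by (simp add: RM_monoid_def negate_at_RM_fin)
  then show False using N fin_equiv_refl by blast
qed

text \<open>Choosing one representative for each generator, every product of classes contains the
  corresponding product of representatives.\<close>

lemma generated_mod_fin_equiv_representative:
  assumes M: "monoid M"
    and R: "R \<subseteq> carrier M" "\<And>A. A \<in> S \<Longrightarrow> A \<inter> R \<noteq> {}"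
    and A: "A \<in> generated_submonoid (mod_fin_equiv M) S"
  shows "\<exists>g \<in> A. g \<in> carrier M \<and> g \<in> generated_submonoid M R"
  using A
proof induction
  case one
  then show ?case
    using monoid.one_closed[OF M] fin_equiv_refl generated_submonoid.one[of M R]
    by (auto simp: mod_fin_equiv_def quotient_monoid_def)
next
  case (incl A)
  then show ?case using R by (blast intro: generated_submonoid.incl)
next
  case (mult A B)
  then obtain a b where ab: "a \<in> A" "b \<in> B" "a \<in> carrier M" "b \<in> carrier M"
    "a \<in> generated_submonoid M R" "b \<in> generated_submonoid M R" by blast
  have c: "a \<otimes>\<^bsub>M\<^esub> b \<in> carrier M" using monoid.m_closed[OF M] ab by blast
  then have "a \<otimes>\<^bsub>M\<^esub> b \<in> A \<otimes>\<^bsub>mod_fin_equiv M\<^esub> B"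
    using ab fin_equiv_refl[of "a \<otimes>\<^bsub>M\<^esub> b"]
    unfolding mod_fin_equiv_def quotient_monoid_def by auto
  then show ?case using c generated_submonoid.mult[OF ab(5,6)] by blast
qed

lemma not_finitely_generated_mod_fin_equiv:
  assumes M: "monoid (RM_monoid P)"
    and P: "\<And>f. P f \<Longrightarrow> plep f" and tfl: "\<And>f. tfl f \<Longrightarrow> P f"
  shows "\<not> finitely_generated_monoid (mod_fin_equiv (RM_monoid P))"
proof
  let ?M = "RM_monoid P"
  let ?r = "{(f, g). f \<in> carrier ?M \<and> g \<in> carrier ?M \<and> fin_equiv f g}"
  have car: "carrier (mod_fin_equiv ?M) = carrier ?M // ?r"
    by (simp add: mod_fin_equiv_def quotient_monoid_def)
  assume "finitely_generated_monoid (mod_fin_equiv ?M)"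
  then obtain S where S: "finite S" "S \<subseteq> carrier ?M // ?r"
    and gen: "generated_submonoid (mod_fin_equiv ?M) S = carrier ?M // ?r"
    unfolding finitely_generated_monoid_def car by blast
  have "\<forall>A\<in>S. \<exists>a. a \<in> A \<and> a \<in> carrier ?M"
    using S(2) fin_equiv_refl by (fastforce simp: quotient_def)
  then obtain rep where rep: "\<And>A. A \<in> S \<Longrightarrow> rep A \<in> A \<and> rep A \<in> carrier ?M" by metis
  have R: "finite (rep ` S)" "rep ` S \<subseteq> carrier ?M" "\<And>A. A \<in> S \<Longrightarrow> A \<inter> rep ` S \<noteq> {}"
    using S(1) rep by blast+
  obtain N where N: "\<And>g. g \<in> generated_submonoid ?M (rep ` S) \<Longrightarrow> \<not> fin_equiv (negate_at N) g"
    using negate_at_not_generated[OF P R(1,2)] by blast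
  have "negate_at N \<in> carrier ?M"
    using tfl[OF tfl_negate_at] by (simp add: RM_monoid_def negate_at_RM_fin)
  then have "?r `` {negate_at N} \<in> generated_submonoid (mod_fin_equiv ?M) S"
    unfolding gen by (rule quotientI)
  from generated_mod_fin_equiv_representative[OF M R(2,3) this]
  obtain g where "g \<in> ?r `` {negate_at N}" "g \<in> generated_submonoid ?M (rep ` S)" by blast
  then show False using N by auto
qed

theorem theorem6p2:
  shows "\<not> finitely_generated_monoid tlepRM \<and>
    \<not> finitely_generated_monoid tflRM \<and>
    \<not> finitely_generated_monoid tlepM \<and>
    \<not> finitely_generated_monoid tflM \<and>
    \<not> finitely_generated_monoid plepRM \<and>
    \<not> finitely_generated_monoid pflRM \<and>
    \<not> finitely_generated_monoid plepM \<and>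
    \<not> finitely_generated_monoid pflM"
proof -
  have plep: "tlep f \<Longrightarrow> plep f" "tfl f \<Longrightarrow> plep f" "pfl f \<Longrightarrow> plep f" for f
    by (simp_all add: tlep_def tfl_def pfl_def)
  have tfl: "tfl f \<Longrightarrow> tlep f" "tfl f \<Longrightarrow> plep f" "tfl f \<Longrightarrow> pfl f" for f
    by (auto simp: tlep_def tfl_def pfl_def)
  note RM = not_finitely_generated_RM_monoid and Q = not_finitely_generated_mod_fin_equiv
  note defs = tlepM_def tflM_def plepM_def pflM_def
    tlepRM_def tflRM_def plepRM_def pflRM_def
  note monoids = monoid_tlepRM monoid_tflRM monoid_plepRM monoid_pflRM
  show ?thesis
    using monoids unfolding defs by (intro conjI RM Q) (auto intro: plep tfl)
qed

end
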